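(* There exist an absolute constant $C > 0$ and an integer $n_0$ such that for all $n \ge n_0$ the following holds. If $r < n/2 - C\sqrt{n}$ and $A, B \subseteq \mathbb{F}_2^n$ are sets with $\mathbb{F}_2^n = B_r(0) \cup A \cup B$, then at least one of $A + A$ and $B + B$ contains a coset of codimension $1$.
   Context: For a real number $r$, $B_r(0) \subseteq \mathbb{F}_2^n$ is the Hamming ball of radius $r$ around $0$, i.e. the set of vectors in $\mathbb{F}_2^n$ with at most $r$ coordinates equal to $1$. For $A \subseteq \mathbb{F}_2^n$, $A + A = \{a + a' : a, a' \in A\}$. A coset of codimension $1$ is a set of the form $v + V$ where $v \in \mathbb{F}_2^n$ and $V \le \mathbb{F}_2^n$ is a linear subspace of dimension $n-1$. *)

theory Defs
  imports
    Complex_Main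
    "HOL-Library.Z2"
    "HOL-Library.Set_Algebras"
    "Jordan_Normal_Form.VS_Connect"
begin

text \<open>The space \<open>F\<^sub>2\<^sup>n\<close> is \<open>carrier_vec n :: bit vec set\<close>, so that \<open>n\<close> can be quantified over. The sumset
  \<open>A + B\<close> and the translate \<open>v +o V\<close> are those of \<open>Set_Algebras\<close>; vectors of
  different dimensions can be added as terms, hence the carrier conditions throughout.\<close>

definition hamming_weight :: "bit vec \<Rightarrow> nat" where
  "hamming_weight x = card {i. i < dim_vec x \<and> x $ i = 1}"

text \<open>The radius is an arbitrary real number; for \<open>r < 0\<close> the ball is empty.\<close>

definition hamming_ball :: "nat \<Rightarrow> real \<Rightarrow> bit vec set" where
  "hamming_ball n r = {x \<in> carrier_vec n. real (hamming_weight x) \<le> r}"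

text \<open>The dimension condition is written additively to avoid the truncated \<open>n - 1\<close> at \<open>n = 0\<close>.\<close>

definition is_coset_codim_1 :: "nat \<Rightarrow> bit vec set \<Rightarrow> bool" where
  "is_coset_codim_1 n S \<longleftrightarrow>
    (\<exists>v \<in> carrier_vec n. \<exists>V.
      subspace class_ring V (module_vec TYPE(bit) n) \<and>
      vectorspace.dim class_ring ((module_vec TYPE(bit) n)\<lparr>carrier := V\<rparr>) + 1 = n \<and>
      S = v +o V)"

end

theory Submission
  imports Defs
begin

text \<open>Suppose neither sumset contains a coset of codimension 1. Then the complements \<open>X\<close> of \<open>A + A\<close>
  and \<open>Y\<close> of \<open>B + B\<close> meet every such coset, and hence \<open>X + Y\<close> spans \<open>F\<^sub>2\<^sup>n\<close>. Write some \<open>x \<in> X\<close>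
  as a sum \<open>(x\<^sub>1 + y\<^sub>1) + \<dots> + (x\<^sub>k + y\<^sub>k)\<close> with \<open>x\<^sub>i \<in> X\<close>, \<open>y\<^sub>i \<in> Y\<close> and \<open>k \<le> n\<close>. A walk that starts
  at \<open>p \<in> A\<close> with steps \<open>x\<^sub>1, y\<^sub>1, x\<^sub>2, y\<^sub>2, \<dots>\<close> and avoids the Hamming ball alternates between \<open>A\<close>
  and \<open>B\<close>, because a step \<open>x\<^sub>i\<close> cannot stay in \<open>A\<close> and a step \<open>y\<^sub>i\<close> cannot stay in \<open>B\<close>. It ends at
  \<open>p + x \<in> A\<close>, which contradicts \<open>x \<notin> A + A\<close>. The same applies to \<open>p \<in> B\<close> and some \<open>y \<in> Y\<close>.

  It remains to find a starting point \<open>p\<close> for which both walks avoid the ball. They are translates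
  by \<open>p\<close> of \<open>O(n)\<close> fixed vectors \<open>w\<close>, and the weight of \<open>p + w\<close> is at least \<open>n/2 - O(\<surd>n)\<close> if the
  sign vectors of \<open>p\<close> and \<open>w\<close> have inner product \<open>O(\<surd>n)\<close>. Spencer's discrepancy theorem provides
  such a \<open>p\<close>.\<close>

section \<open>Spencer's discrepancy theorem\<close>

text \<open>The power series compare termwise, because \<open>fact (2 * k)\<close> is at least
  \<open>2 ^ k * fact k\<close>.\<close>

lemma cosh_le_exp_half_square: "cosh x \<le> exp (x\<^sup>2 / 2)" for x :: real
proof -
  \<comment> \<open>The series of \<open>exp (x\<^sup>2 / 2)\<close>, spread over the even indices
    so that it matches the series of \<open>cosh\<close> index by index.\<close>
  define g where "g n = (if even n then (x\<^sup>2 / 2) ^ (n div 2) /\<^sub>R fact (n div 2) else 0)" for n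
  have "(\<lambda>n. g (2 * n)) sums exp (x\<^sup>2 / 2)"
    using exp_converges[of "x\<^sup>2 / 2"] by (simp add: g_def)
  then have g: "g sums exp (x\<^sup>2 / 2)"
    by (rule iffD1[OF sums_mono_reindex, rotated -1])
      (auto simp: strict_mono_def g_def elim!: evenE)
  have fact_double: "2 ^ k * fact k \<le> (fact (2 * k) :: real)" for k :: nat
  proof (induction k)
    case (Suc k)
    have "2 ^ Suc k * fact (Suc k) = (2 * real (Suc k)) * (2 ^ k * fact k)"
      by simp
    also have "\<dots> \<le> (2 * real (Suc k)) * fact (2 * k)"
      using Suc by (intro mult_left_mono) auto
    also have "\<dots> \<le> (2 * real (Suc k)) * ((2 * real k + 1) * fact (2 * k))"
      by (intro mult_left_mono) (auto simp: mult_le_cancel_right1)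
    also have "\<dots> = fact (2 * Suc k)"
      by (simp add: algebra_simps)
    finally show ?case .
  qed simp
  show ?thesis
  proof (rule sums_le[OF _ cosh_converges g])
    fix n
    show "(if even n then x ^ n /\<^sub>R fact n else 0) \<le> g n"
    proof (cases "even n")
      case True
      then obtain k where k: "n = 2 * k" by (elim evenE)
      have "x ^ n / fact n \<le> (x\<^sup>2) ^ k / (2 ^ k * fact k)"
        unfolding k power_mult by (intro divide_left_mono fact_double mult_pos_pos) auto
      then show ?thesis
        by (simp add: g_def k power_divide field_simps)
    qed (simp add: g_def)
  qed
qed

text \<open>This bounds the partition function of one integer coordinate with energy
  \<open>L * \<bar>k\<bar>\<close>. A finite part of the two-sided geometric series with ratio
  \<open>q = exp (- L) \<le> 1/2\<close> is at most
  \<open>1 + 2 * q / (1 - q) \<le> 1 + 4 * q \<le> exp (4 * q)\<close>.\<close>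

lemma sum_geometric_int_le:
  fixes F :: "int set"
  assumes "finite F" "L \<ge> 1"
  shows "(\<Sum>k\<in>F. exp (- (L * \<bar>real_of_int k\<bar>))) \<le> exp (4 * exp (- L))"
proof -
  define q where "q = exp (- L)"
  have q: "0 < q" "q \<le> 1/2"
  proof -
    have "exp L \<ge> 2" using exp_ge_add_one_self[of L] assms by linarith
    then show "q \<le> 1/2" by (simp add: q_def exp_minus field_simps)
  qed (simp add: q_def)
  define f where "f k = q ^ nat \<bar>k\<bar>" for k :: int
  have f: "exp (- (L * \<bar>real_of_int k\<bar>)) = f k" for k
  proof -
    have "\<bar>real_of_int k\<bar> = real (nat \<bar>k\<bar>)" by simp
    then show ?thesis
      unfolding f_def q_def by (metis exp_of_nat_mult mult.commute mult_minus_right)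
  qed
  have sym: "(\<Sum>k\<in>{- int M..int M}. f k) = 1 + 2 * (\<Sum>j<M. q ^ Suc j)" for M
  proof (induction M)
    case (Suc M)
    have "{- int (Suc M)..int (Suc M)} = insert (- int (Suc M)) (insert (int (Suc M)) {- int M..int M})"
      by auto
    moreover have "f (- int (Suc M)) = q ^ Suc M" "f (int (Suc M)) = q ^ Suc M"
      unfolding f_def by (metis abs_minus abs_of_nat nat_int)+
    ultimately show ?case using Suc by simp
  qed (simp add: f_def)
  obtain M where M: "F \<subseteq> {- int M..int M}"
  proof -
    obtain B where "\<forall>k\<in>F. \<bar>k\<bar> \<le> B"
      using assms(1) by (metis finite_imageI finite_nat_set_iff_bounded_le Max_ge image_eqI)
    then show thesis by (intro that[of "nat B"]) force
  qed
  have "(\<Sum>j<M. q ^ Suc j) = q * ((1 - q ^ M) / (1 - q))"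
    using q sum_gp_strict[of q M] by (simp add: sum_distrib_left[symmetric])
  also have "\<dots> \<le> q * 2"
  proof (intro mult_left_mono)
    have "0 \<le> q ^ M" using q by simp
    moreover have "1 \<le> 2 * (1 - q)" using q by simp
    ultimately have "1 - q ^ M \<le> 2 * (1 - q)" by linarith
    then show "(1 - q ^ M) / (1 - q) \<le> 2" using q by (simp add: pos_divide_le_eq)
  qed (use q in simp)
  finally have geo: "(\<Sum>j<M. q ^ Suc j) \<le> q * 2" .
  have "(\<Sum>k\<in>F. f k) \<le> (\<Sum>k\<in>{- int M..int M}. f k)"
    using M q by (intro sum_mono2) (auto simp: f_def)
  also have "\<dots> \<le> 1 + 4 * q"
    using geo unfolding sym by linarith
  also have "\<dots> \<le> exp (4 * q)"
    by (rule exp_ge_add_one_self)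
  finally show ?thesis by (simp add: f q_def)
qed

text \<open>Pigeonhole principle in the form of Gibbs' inequality: the entropy of \<open>b\<close> is at most the
  mean energy plus the logarithm of the partition function of the energy \<open>L \<bar>k\<bar>\<close>, so some fibre
  of \<open>b\<close> is correspondingly large.\<close>

lemma exists_large_fibre:
  fixes b :: "'i \<Rightarrow> 'w \<Rightarrow> int" and L m :: real
  assumes fin: "finite \<Omega>" "\<Omega> \<noteq> {}" "finite I" and L: "L \<ge> 1"
    and m: "(\<Sum>\<omega>\<in>\<Omega>. \<Sum>i\<in>I. L * \<bar>real_of_int (b i \<omega>)\<bar>) \<le> m * card \<Omega>"
  obtains \<omega>\<^sub>0 where "\<omega>\<^sub>0 \<in> \<Omega>"
    "card \<Omega> * exp (- m - 4 * exp (- L) * card I) \<le> card {\<omega> \<in> \<Omega>. \<forall>i\<in>I. b i \<omega> = b i \<omega>\<^sub>0}"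
proof -
  define \<Phi> where "\<Phi> \<omega> = (\<Sum>i\<in>I. L * \<bar>real_of_int (b i \<omega>)\<bar>)" for \<omega>
  define \<beta> where "\<beta> \<omega> = restrict (\<lambda>i. b i \<omega>) I" for \<omega>
  define fib where "fib \<omega> = card {\<omega>' \<in> \<Omega>. \<beta> \<omega>' = \<beta> \<omega>}" for \<omega>
  define e where "e c = (\<Prod>i\<in>I. exp (- (L * \<bar>real_of_int (c i)\<bar>)))" for c :: "'i \<Rightarrow> int"
  have \<beta>_eq: "\<beta> \<omega>' = \<beta> \<omega> \<longleftrightarrow> (\<forall>i\<in>I. b i \<omega>' = b i \<omega>)" for \<omega> \<omega>'
    unfolding \<beta>_def by (auto simp: restrict_def fun_eq_iff)
  have e: "e (\<beta> \<omega>) = exp (- \<Phi> \<omega>)" for \<omega>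
    unfolding e_def \<Phi>_def sum_negf[symmetric] exp_sum[OF fin(3)]
    by (intro prod.cong) (auto simp: \<beta>_def)
  have fib_pos: "fib \<omega> > 0" if "\<omega> \<in> \<Omega>" for \<omega>
    using that fin(1) by (auto simp: fib_def card_gt_0_iff)
  \<comment> \<open>Dividing by the fibre size makes each fibre contribute \<open>e c\<close>
    exactly once. The attained patterns lie in a product box, over which the sum of \<open>e\<close>
    factorises into one-coordinate partition functions.\<close>
  have "(\<Sum>\<omega>\<in>\<Omega>. e (\<beta> \<omega>) / fib \<omega>)
      = (\<Sum>c\<in>\<beta> ` \<Omega>. \<Sum>\<omega>\<in>{\<omega>\<in>\<Omega>. \<beta> \<omega> = c}. e (\<beta> \<omega>) / fib \<omega>)"
    using fin(1) by (rule sum.image_gen)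
  also have "\<dots> = (\<Sum>c\<in>\<beta> ` \<Omega>. e c)"
  proof (rule sum.cong)
    fix c assume "c \<in> \<beta> ` \<Omega>"
    then obtain \<omega>\<^sub>1 where "\<omega>\<^sub>1 \<in> \<Omega>" "c = \<beta> \<omega>\<^sub>1" by blast
    moreover have "(\<Sum>\<omega>\<in>{\<omega>\<in>\<Omega>. \<beta> \<omega> = c}. e (\<beta> \<omega>) / fib \<omega>)
      = (\<Sum>\<omega>\<in>{\<omega>\<in>\<Omega>. \<beta> \<omega> = c}. e c / card {\<omega>\<in>\<Omega>. \<beta> \<omega> = c})"
      by (intro sum.cong) (auto simp: fib_def)
    ultimately show "(\<Sum>\<omega>\<in>{\<omega>\<in>\<Omega>. \<beta> \<omega> = c}. e (\<beta> \<omega>) / fib \<omega>) = e c"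
      using fib_pos[of \<omega>\<^sub>1] by (simp add: fib_def)
  qed simp
  also have "\<dots> \<le> (\<Sum>c\<in>(\<Pi>\<^sub>E i\<in>I. b i ` \<Omega>). e c)"
    using fin by (intro sum_mono2 finite_PiE) (auto simp: \<beta>_def e_def intro: prod_nonneg)
  also have "\<dots> = (\<Prod>i\<in>I. \<Sum>k\<in>b i ` \<Omega>. exp (- (L * \<bar>real_of_int k\<bar>)))"
    unfolding e_def using fin by (subst prod_sum_PiE) auto
  also have "\<dots> \<le> (\<Prod>i\<in>I. exp (4 * exp (- L)))"
    using fin L by (intro prod_mono conjI sum_nonneg sum_geometric_int_le) auto
  also have "\<dots> = exp (4 * exp (- L) * card I)"
    by (simp add: exp_of_nat_mult[symmetric] mult.commute)
  finally have upper: "(\<Sum>\<omega>\<in>\<Omega>. exp (- \<Phi> \<omega>) / fib \<omega>) \<le> exp (4 * exp (- L) * card I)"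
    by (simp add: e)
  \<comment> \<open>Jensen's inequality by hand: \<open>1 + t \<le> exp t\<close> is applied at
    \<open>t = m - \<Phi> \<omega>\<close>, and the mean of \<open>\<Phi>\<close> is at most
    \<open>m\<close>.\<close>
  have "exp (- m) * card \<Omega> \<le> exp (- m) * (\<Sum>\<omega>\<in>\<Omega>. 1 + m - \<Phi> \<omega>)"
    using m by (simp add: \<Phi>_def[symmetric] sum_subtractf algebra_simps)
  also have "\<dots> = (\<Sum>\<omega>\<in>\<Omega>. exp (- m) * (1 + (m - \<Phi> \<omega>)))"
    by (simp add: sum_distrib_left algebra_simps)
  also have "\<dots> \<le> (\<Sum>\<omega>\<in>\<Omega>. exp (- m) * exp (m - \<Phi> \<omega>))"
    by (intro sum_mono mult_left_mono exp_ge_add_one_self) auto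
  also have "\<dots> = (\<Sum>\<omega>\<in>\<Omega>. exp (- \<Phi> \<omega>))"
    by (simp add: exp_add[symmetric])
  finally have lower: "exp (- m) * card \<Omega> \<le> (\<Sum>\<omega>\<in>\<Omega>. exp (- \<Phi> \<omega>))" .
  define s where "s = card \<Omega> * exp (- m - 4 * exp (- L) * card I)"
  have s: "s > 0" using fin by (simp add: s_def card_gt_0_iff)
  have "\<exists>\<omega>\<in>\<Omega>. s \<le> fib \<omega>"
  proof (rule ccontr)
    assume "\<not> ?thesis"
    then have less: "fib \<omega> < s" if "\<omega> \<in> \<Omega>" for \<omega> using that by force
    \<comment> \<open>The value \<open>s\<close> makes the bound \<open>lower\<close>, divided by
      \<open>s\<close>, equal to the bound in \<open>upper\<close>. If all fibres were smaller than
      \<open>s\<close>, the sum would lie strictly above it.\<close>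
    have "exp (4 * exp (- L) * card I) = exp (- m) * card \<Omega> / s"
      using fin by (simp add: s_def card_gt_0_iff exp_diff)
    also have "\<dots> \<le> (\<Sum>\<omega>\<in>\<Omega>. exp (- \<Phi> \<omega>)) / s"
      using lower s by (simp add: divide_right_mono)
    also have "\<dots> = (\<Sum>\<omega>\<in>\<Omega>. exp (- \<Phi> \<omega>) / s)"
      by (simp add: sum_divide_distrib)
    also have "\<dots> < (\<Sum>\<omega>\<in>\<Omega>. exp (- \<Phi> \<omega>) / fib \<omega>)"
      using fin less fib_pos s by (intro sum_strict_mono divide_strict_left_mono) auto
    finally show False using upper by simp
  qed
  then show thesis
    using that by (auto simp: fib_def \<beta>_eq s_def)
qed

section \<open>Counting and exponential moments on the sign cube\<close>

text \<open>A Chernoff-type count. Weight a sign vector at distance \<open>d\<close> from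
  \<open>\<omega>\<^sub>0\<close> by \<open>exp (- 2 * d)\<close>. Members of \<open>F\<close> have
  weight at least \<open>exp (- (card J / 4))\<close>, while the whole cube has weight
  \<open>(1 + exp (-2)) ^ card J \<le> exp (card J / 4)\<close>.\<close>

lemma card_close_sign_vectors_le:
  fixes \<omega>\<^sub>0 :: "'a \<Rightarrow> real"
  assumes J: "finite J" and \<omega>\<^sub>0: "\<omega>\<^sub>0 \<in> J \<rightarrow>\<^sub>E {-1, 1}"
    and F: "F \<subseteq> J \<rightarrow>\<^sub>E {-1, 1}" "\<And>\<omega>. \<omega> \<in> F \<Longrightarrow> 8 * card {j\<in>J. \<omega> j \<noteq> \<omega>\<^sub>0 j} \<le> card J"
  shows "card F \<le> exp (card J / 2)"
proof -
  have finF: "finite F"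
    by (rule finite_subset[OF F(1)]) (intro finite_PiE J, auto)
  have exp2: "exp (-2) \<le> (1/4 :: real)"
  proof -
    have "(2::real) * 2 \<le> exp 1 * exp 1"
      using exp_ge_add_one_self[of "1::real"] by (intro mult_mono) auto
    then show ?thesis by (simp add: exp_add[symmetric] exp_minus field_simps)
  qed
  define w where "w \<omega> = (\<Prod>j\<in>J. if \<omega> j \<noteq> \<omega>\<^sub>0 j then exp (-2) else (1::real))" for \<omega>
  have w: "w \<omega> = exp (- 2 * real (card {j\<in>J. \<omega> j \<noteq> \<omega>\<^sub>0 j}))" for \<omega>
  proof -
    have "w \<omega> = (\<Prod>j\<in>{j\<in>J. \<omega> j \<noteq> \<omega>\<^sub>0 j}. exp (-2))"
      unfolding w_def by (rule prod.inter_filter[symmetric, OF J])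
    also have "\<dots> = exp (- 2 * real (card {j\<in>J. \<omega> j \<noteq> \<omega>\<^sub>0 j}))"
      by (simp add: exp_of_nat_mult[symmetric] mult.commute)
    finally show ?thesis .
  qed
  have "card F * exp (- (card J / 4)) = (\<Sum>\<omega>\<in>F. exp (- (card J / 4)))"
    by simp
  also have "\<dots> \<le> (\<Sum>\<omega>\<in>F. w \<omega>)"
  proof (intro sum_mono)
    fix \<omega> assume "\<omega> \<in> F"
    then have "8 * real (card {j\<in>J. \<omega> j \<noteq> \<omega>\<^sub>0 j}) \<le> card J"
      using F(2)[of \<omega>] by linarith
    then show "exp (- (card J / 4)) \<le> w \<omega>" by (simp add: w)
  qed
  also have "\<dots> \<le> (\<Sum>\<omega>\<in>J \<rightarrow>\<^sub>E {-1, 1}. w \<omega>)"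
    using F(1) J by (intro sum_mono2 finite_PiE) (auto simp: w)
  also have "\<dots> = (\<Prod>j\<in>J. \<Sum>s\<in>{-1, 1}. if s \<noteq> \<omega>\<^sub>0 j then exp (-2) else (1::real))"
    unfolding w_def using J by (subst prod_sum_PiE) auto
  also have "\<dots> = (\<Prod>j\<in>J. 1 + exp (-2))"
  proof (intro prod.cong)
    fix j assume "j \<in> J"
    then have "\<omega>\<^sub>0 j = -1 \<or> \<omega>\<^sub>0 j = 1" using \<omega>\<^sub>0 by (auto simp: PiE_def Pi_def)
    then show "(\<Sum>s\<in>{-1, 1}. if s \<noteq> \<omega>\<^sub>0 j then exp (-2) else (1::real)) = 1 + exp (-2)"
      by auto
  qed simp
  also have "\<dots> \<le> (\<Prod>j\<in>J. exp (1/4))"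
  proof (intro prod_mono conjI)
    show "1 + exp (-2) \<le> exp (1/4 :: real)"
      using exp_ge_add_one_self[of "1/4 :: real"] exp2 by linarith
  qed (simp add: add_nonneg_nonneg)
  also have "\<dots> = exp (card J / 4)"
    by (simp add: exp_of_nat_mult[symmetric])
  finally have "card F \<le> exp (card J / 4) / exp (- (card J / 4))"
    by (simp add: pos_le_divide_eq)
  also have "\<dots> = exp (card J / 2)"
    by (simp add: exp_diff[symmetric])
  finally show ?thesis .
qed

text \<open>The moment generating function of a random sign sum: it factorises over
  \<open>J\<close>, and each factor is \<open>2 * cosh \<tau>\<close>.\<close>

lemma sum_exp_sign_sum_le:
  fixes u :: "'a \<Rightarrow> real" and \<tau> :: real
  assumes J: "finite J" and u: "\<And>j. j \<in> J \<Longrightarrow> u j \<in> {-1, 1}"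
  shows "(\<Sum>\<omega>\<in>J \<rightarrow>\<^sub>E {-1, 1}. exp (\<tau> * (\<Sum>j\<in>J. \<omega> j * u j))) \<le> 2 ^ card J * exp (card J * \<tau>\<^sup>2 / 2)"
proof -
  have "(\<Sum>\<omega>\<in>J \<rightarrow>\<^sub>E {-1, 1}. exp (\<tau> * (\<Sum>j\<in>J. \<omega> j * u j)))
      = (\<Sum>\<omega>\<in>J \<rightarrow>\<^sub>E {-1, 1}. \<Prod>j\<in>J. exp (\<tau> * (\<omega> j * u j)))"
    by (simp add: sum_distrib_left exp_sum[OF J])
  also have "\<dots> = (\<Prod>j\<in>J. \<Sum>s\<in>{-1, 1}. exp (\<tau> * (s * u j)))"
    using J by (subst prod_sum_PiE) auto
  also have "\<dots> = (\<Prod>j\<in>J. 2 * cosh \<tau>)"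
  proof (intro prod.cong)
    fix j assume "j \<in> J"
    then have "u j = -1 \<or> u j = 1" using u by auto
    then show "(\<Sum>s\<in>{-1, 1}. exp (\<tau> * (s * u j))) = 2 * cosh \<tau>"
      by (auto simp: cosh_field_def)
  qed simp
  also have "\<dots> \<le> (\<Prod>j\<in>J. 2 * exp (\<tau>\<^sup>2 / 2))"
    using cosh_le_exp_half_square[of \<tau>] by (intro prod_mono) auto
  also have "\<dots> = 2 ^ card J * exp (card J * \<tau>\<^sup>2 / 2)"
    by (simp add: power_mult_distrib exp_of_nat_mult[symmetric])
  finally show ?thesis .
qed

section \<open>Partial signings\<close>

text \<open>The entropy method. Rounding all the sums at scale \<open>2 * T\<close> leaves so little
  entropy that more than \<open>exp (card J / 2)\<close> sign vectors share all rounded values. Two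
  of them then differ on more than an eighth of \<open>J\<close>, and half their difference is the
  signing, supported on the set \<open>P\<close> where they differ.\<close>

lemma exists_balanced_partial_signing:
  fixes v :: "'i \<Rightarrow> 'a \<Rightarrow> real" and N :: real
  assumes J: "finite J" "J \<noteq> {}" and I: "finite I" "card I \<le> N" and N: "card J \<le> N"
    and v: "\<And>i j. i \<in> I \<Longrightarrow> j \<in> J \<Longrightarrow> v i j \<in> {-1, 1}"
  obtains P s where "P \<subseteq> J" "card J < 8 * card P" "\<And>j. j \<in> P \<Longrightarrow> s j \<in> {-1, 1}"
    "\<And>i. i \<in> I \<Longrightarrow> \<bar>\<Sum>j\<in>P. s j * v i j\<bar> \<le> 9 * sqrt (sqrt (N * card J))"
proof -
  define n where "n = real (card J)"
  define \<Omega> where "\<Omega> = (J \<rightarrow>\<^sub>E {-1, 1 :: real})"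
  define S where "S i \<omega> = (\<Sum>j\<in>J. \<omega> j * v i j)" for i and \<omega> :: "'a \<Rightarrow> real"
  define T where "T = 9 * sqrt (sqrt (N * n))"
  \<comment> \<open>This is \<open>T\<^sup>2 / (2 * n)\<close>, the exponent of the Gaussian tail at
    deviation \<open>T\<close>. It also serves as the parameter \<open>L\<close> of
    \<open>exists_large_fibre\<close>.\<close>
  define x where "x = 81 * sqrt (N / n) / 2"
  \<comment> \<open>The nearest integer to \<open>S i \<omega> / (2 * T)\<close>; it vanishes for
    \<open>S i \<omega>\<close> in the interval from \<open>- T\<close> to \<open>T\<close>.\<close>
  define b where "b i \<omega> = \<lfloor>S i \<omega> / (2 * T) + 1 / 2\<rfloor>" for i and \<omega> :: "'a \<Rightarrow> real"
  have n: "n \<ge> 1" "n > 0" using J by (auto simp: n_def card_gt_0_iff Suc_le_eq)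
  have nN: "n \<le> N" using N by (simp add: n_def)
  have Npos: "N > 0" using n nN by linarith
  have T: "T > 0" using n Npos by (simp add: T_def)
  have Tsq: "T\<^sup>2 = 2 * x * n"
  proof -
    have "T\<^sup>2 = 81 * sqrt (N * n)" using n Npos by (simp add: T_def power_mult_distrib)
    moreover have "sqrt (N * n) = sqrt (N / n) * n"
    proof -
      have "sqrt (N / n) * n = sqrt (N / n) * sqrt (n * n)" using n by simp
      also have "\<dots> = sqrt ((N / n) * (n * n))" by (rule real_sqrt_mult[symmetric])
      finally show ?thesis using n by simp
    qed
    ultimately show ?thesis by (simp add: x_def)
  qed
  have y: "N / n \<ge> 1" using n nN by simp
  then have x: "x \<ge> 1" using real_sqrt_ge_1_iff[of "N / n"] unfolding x_def by linarith
  have ysq: "N / n = (2 * x / 81)\<^sup>2"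
    using y by (simp add: x_def)
  have fin\<Omega>: "finite \<Omega>" unfolding \<Omega>_def using J by (intro finite_PiE) auto
  have card\<Omega>: "card \<Omega> = 2 ^ card J"
    unfolding \<Omega>_def using J by (subst card_PiE) (auto simp: numeral_2_eq_2)
  have \<Omega>: "\<Omega> \<noteq> {}" using card\<Omega> by auto
  \<comment> \<open>Where \<open>b\<close> is nonzero, \<open>\<bar>z\<bar> \<ge> 1\<close> for
    \<open>z = S i \<omega> / T\<close>, so the linear size of \<open>b\<close> is absorbed into
    \<open>exp (2 * x * (\<bar>z\<bar> - 1))\<close>. The absolute value is traded for a sum of two
    exponentials, to which the moment bound applies.\<close>
  have b_le: "\<bar>real_of_int (b i \<omega>)\<bar>
      \<le> exp (- 2 * x) * (exp ((2 * x / T) * S i \<omega>) + exp (- (2 * x / T) * S i \<omega>))" for i \<omega>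
  proof (cases "b i \<omega> = 0")
    case False
    define z where "z = S i \<omega> / T"
    have bz: "b i \<omega> = \<lfloor>z / 2 + 1 / 2\<rfloor>" by (simp add: b_def z_def mult.commute)
    have "real_of_int (b i \<omega>) \<le> z / 2 + 1 / 2" "z / 2 - 1 / 2 < real_of_int (b i \<omega>)"
      unfolding bz by linarith+
    moreover have "\<bar>z\<bar> \<ge> 1"
    proof (rule ccontr)
      assume "\<not> ?thesis"
      then have "0 \<le> z / 2 + 1 / 2" "z / 2 + 1 / 2 < 1" by linarith+
      then have "b i \<omega> = 0" unfolding bz by linarith
      then show False using False by simp
    qed
    ultimately have "\<bar>real_of_int (b i \<omega>)\<bar> \<le> \<bar>z\<bar>" by linarith
    also have "\<dots> \<le> exp (\<bar>z\<bar> - 1)" using exp_ge_add_one_self[of "\<bar>z\<bar> - 1"] by simp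
    also have "\<dots> \<le> exp (2 * x * (\<bar>z\<bar> - 1))"
      using x \<open>\<bar>z\<bar> \<ge> 1\<close> mult_right_mono[of 1 "2 * x" "\<bar>z\<bar> - 1"] by simp
    also have "\<dots> = exp (- 2 * x) * exp (2 * x * \<bar>z\<bar>)"
      by (simp add: exp_add[symmetric] algebra_simps)
    also have "\<dots> \<le> exp (- 2 * x) * (exp (2 * x * z) + exp (- 2 * x * z))"
      by (intro mult_left_mono) (auto simp: abs_if)
    finally show ?thesis by (simp add: z_def)
  qed (simp add: add_nonneg_nonneg)
  have sum_b: "(\<Sum>\<omega>\<in>\<Omega>. \<bar>real_of_int (b i \<omega>)\<bar>) \<le> 2 ^ card J * (2 * exp (- x))" if i: "i \<in> I" for i
  proof -
    \<comment> \<open>With \<open>\<tau> = 2 * x / T\<close> the moment bound costs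
      \<open>exp x\<close>, so a factor \<open>exp (- x)\<close> remains of
      \<open>exp (- 2 * x)\<close>.\<close>
    have quad: "n * (2 * x / T)\<^sup>2 / 2 = x"
      unfolding power_divide Tsq using n x by (simp add: power2_eq_square)
    have "(\<Sum>\<omega>\<in>\<Omega>. \<bar>real_of_int (b i \<omega>)\<bar>)
        \<le> (\<Sum>\<omega>\<in>\<Omega>. exp (- 2 * x) * (exp ((2 * x / T) * S i \<omega>) + exp (- (2 * x / T) * S i \<omega>)))"
      by (intro sum_mono b_le)
    also have "\<dots> = exp (- 2 * x) * ((\<Sum>\<omega>\<in>\<Omega>. exp ((2 * x / T) * S i \<omega>))
        + (\<Sum>\<omega>\<in>\<Omega>. exp (- (2 * x / T) * S i \<omega>)))"
      by (simp only: sum_distrib_left[symmetric] sum.distrib)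
    also have "\<dots> \<le> exp (- 2 * x) * (2 ^ card J * exp x + 2 ^ card J * exp x)"
      using sum_exp_sign_sum_le[of J "v i" "2 * x / T"] sum_exp_sign_sum_le[of J "v i" "- (2 * x / T)"]
        J v i quad
      unfolding S_def \<Omega>_def n_def[symmetric] by (intro mult_left_mono add_mono) auto
    also have "\<dots> = 2 ^ card J * (2 * (exp (- 2 * x) * exp x))"
      by simp
    also have "exp (- 2 * x) * exp x = exp (- x)"
      by (simp add: exp_add[symmetric])
    finally show ?thesis .
  qed
  have total: "(\<Sum>\<omega>\<in>\<Omega>. \<Sum>i\<in>I. x * \<bar>real_of_int (b i \<omega>)\<bar>) \<le> (2 * x * exp (- x) * N) * card \<Omega>"
  proof -
    have "(\<Sum>\<omega>\<in>\<Omega>. \<Sum>i\<in>I. x * \<bar>real_of_int (b i \<omega>)\<bar>)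
        = x * (\<Sum>i\<in>I. \<Sum>\<omega>\<in>\<Omega>. \<bar>real_of_int (b i \<omega>)\<bar>)"
      by (subst sum.swap) (simp add: sum_distrib_left)
    also have "\<dots> \<le> x * (\<Sum>i\<in>I. 2 ^ card J * (2 * exp (- x)))"
      using x by (intro mult_left_mono sum_mono sum_b) auto
    also have "\<dots> = (2 * x * exp (- x) * 2 ^ card J) * card I"
      by simp
    also have "\<dots> \<le> (2 * x * exp (- x) * 2 ^ card J) * N"
      using I x by (intro mult_left_mono) auto
    finally show ?thesis by (simp add: card\<Omega> mult_ac)
  qed
  obtain \<omega>\<^sub>0 where \<omega>\<^sub>0: "\<omega>\<^sub>0 \<in> \<Omega>" and large: "card \<Omega> * exp (- (2 * x * exp (- x) * N) - 4 * exp (- x) * card I)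
      \<le> card {\<omega> \<in> \<Omega>. \<forall>i\<in>I. b i \<omega> = b i \<omega>\<^sub>0}"
    by (rule exists_large_fibre[OF fin\<Omega> \<Omega> I(1) x total])
  define F where "F = {\<omega> \<in> \<Omega>. \<forall>i\<in>I. b i \<omega> = b i \<omega>\<^sub>0}"
  \<comment> \<open>The constant 9 in \<open>T\<close> is chosen for this estimate:
    \<open>N / n\<close> is a multiple of \<open>x\<^sup>2\<close>, so the left side is at most a
    multiple of \<open>n * x ^ 3 * exp (- x)\<close>. Since \<open>x ^ 3 \<le> 27 * exp x\<close>,
    the final factor is 648/6561, just below 1/10.\<close>
  have exponent: "2 * x * exp (- x) * N + 4 * exp (- x) * card I \<le> n / 10"
  proof -
    have "(x / 3) ^ 3 \<le> exp (x / 3) ^ 3"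
      using x exp_ge_add_one_self[of "x / 3"] by (intro power_mono) linarith+
    also have "\<dots> = exp x" by (simp add: exp_of_nat_mult[symmetric])
    finally have cube: "x ^ 3 / 27 * exp (- x) \<le> 1"
      by (simp add: exp_minus field_simps power3_eq_cube)
    have "2 * x * exp (- x) * N + 4 * exp (- x) * card I \<le> 2 * x * exp (- x) * N + 4 * exp (- x) * (x * N)"
    proof (intro add_left_mono mult_left_mono)
      have "1 * N \<le> x * N" using x Npos by (intro mult_right_mono) auto
      then show "card I \<le> x * N" using I by linarith
    qed auto
    also have "\<dots> = 6 * x * exp (- x) * n * (N / n)"
      using n by (simp add: algebra_simps)
    also have "\<dots> = (n * (24 * 27 / 6561)) * (x ^ 3 / 27 * exp (- x))"
      unfolding ysq by (simp add: power2_eq_square power3_eq_cube)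
    also have "\<dots> \<le> (n * (24 * 27 / 6561)) * 1"
      using n cube by (intro mult_left_mono) auto
    also have "\<dots> \<le> n / 10" using n by simp
    finally show ?thesis .
  qed
  have "exp (n / 2) < card F"
  proof -
    \<comment> \<open>The exponent 6/10 is 1/2 for the ball count plus 1/10 for the entropy loss;
      the comparison reduces to \<open>3 ^ 6 < 2 ^ 10\<close>.\<close>
    have "exp (6 / 10 :: real) < 2"
    proof (rule power_less_imp_less_base)
      have "exp (6 / 10 :: real) ^ 10 = exp 1 ^ 6"
        by (simp add: exp_of_nat_mult[symmetric])
      also have "\<dots> \<le> 3 ^ 6" using exp_le by (intro power_mono) auto
      finally show "exp (6 / 10 :: real) ^ 10 < 2 ^ 10" by simp
    qed simp
    then have "exp (6 / 10) ^ card J < (2 :: real) ^ card J"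
      using J by (intro power_strict_mono) (auto simp: card_gt_0_iff)
    also have "exp (6 / 10) ^ card J = exp (n / 2 + n / 10)"
      by (simp add: exp_of_nat_mult[symmetric] n_def)
    finally have "exp (n / 2) * exp (n / 10) < card \<Omega>"
      unfolding exp_add card\<Omega> by simp
    then have "exp (n / 2) < card \<Omega> * exp (- (n / 10))"
      by (simp add: exp_minus field_simps)
    also have "\<dots> \<le> card \<Omega> * exp (- (2 * x * exp (- x) * N) - 4 * exp (- x) * card I)"
      using exponent by (intro mult_left_mono) auto
    finally show ?thesis using large by (simp add: F_def)
  qed
  moreover have "F \<subseteq> J \<rightarrow>\<^sub>E {-1, 1}" by (auto simp: F_def \<Omega>_def)
  ultimately obtain \<omega>\<^sub>1 where \<omega>\<^sub>1: "\<omega>\<^sub>1 \<in> F" and far: "card J < 8 * card {j\<in>J. \<omega>\<^sub>1 j \<noteq> \<omega>\<^sub>0 j}"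
    using card_close_sign_vectors_le[of J \<omega>\<^sub>0 F] J \<omega>\<^sub>0 unfolding \<Omega>_def n_def by force
  define P where "P = {j\<in>J. \<omega>\<^sub>1 j \<noteq> \<omega>\<^sub>0 j}"
  have sign: "\<omega>\<^sub>1 j = 1 \<or> \<omega>\<^sub>1 j = -1" "\<omega>\<^sub>0 j = 1 \<or> \<omega>\<^sub>0 j = -1" if "j \<in> J" for j
    using \<omega>\<^sub>0 \<omega>\<^sub>1 that by (auto simp: F_def \<Omega>_def PiE_def Pi_def)
  show thesis
  proof (rule that)
    show "P \<subseteq> J" "card J < 8 * card P" using far by (auto simp: P_def)
    show "\<omega>\<^sub>1 j \<in> {-1, 1}" if "j \<in> P" for j using sign(1)[of j] that by (auto simp: P_def)
    fix i assume i: "i \<in> I"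
    have "2 * (\<Sum>j\<in>P. \<omega>\<^sub>1 j * v i j) = (\<Sum>j\<in>P. (\<omega>\<^sub>1 j - \<omega>\<^sub>0 j) * v i j)"
      unfolding sum_distrib_left
    proof (rule sum.cong)
      fix j assume "j \<in> P"
      then have "\<omega>\<^sub>1 j - \<omega>\<^sub>0 j = 2 * \<omega>\<^sub>1 j" using sign[of j] by (auto simp: P_def)
      then show "2 * (\<omega>\<^sub>1 j * v i j) = (\<omega>\<^sub>1 j - \<omega>\<^sub>0 j) * v i j" by simp
    qed simp
    also have "\<dots> = (\<Sum>j\<in>J. (\<omega>\<^sub>1 j - \<omega>\<^sub>0 j) * v i j)"
      using J by (intro sum.mono_neutral_left) (auto simp: P_def)
    also have "\<dots> = S i \<omega>\<^sub>1 - S i \<omega>\<^sub>0"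
      by (simp add: S_def sum_subtractf left_diff_distrib)
    finally have diff: "2 * (\<Sum>j\<in>P. \<omega>\<^sub>1 j * v i j) = S i \<omega>\<^sub>1 - S i \<omega>\<^sub>0" .
    have "\<lfloor>S i \<omega>\<^sub>1 / (2 * T) + 1 / 2\<rfloor> = \<lfloor>S i \<omega>\<^sub>0 / (2 * T) + 1 / 2\<rfloor>"
      using \<omega>\<^sub>1 i by (simp add: F_def b_def)
    \<comment> \<open>Equal rounded values place both sums in one cell of width
      \<open>2 * T\<close>; halving the difference leaves \<open>T\<close>.\<close>
    then have "\<bar>S i \<omega>\<^sub>1 / (2 * T) - S i \<omega>\<^sub>0 / (2 * T)\<bar> \<le> 1" by linarith
    then have "\<bar>S i \<omega>\<^sub>1 - S i \<omega>\<^sub>0\<bar> \<le> 2 * T"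
      using T by (simp add: diff_divide_distrib[symmetric] abs_divide pos_divide_le_eq)
    then show "\<bar>\<Sum>j\<in>P. \<omega>\<^sub>1 j * v i j\<bar> \<le> 9 * sqrt (sqrt (N * card J))"
      using diff unfolding T_def n_def by linarith
  qed
qed

text \<open>Spencer's ``six standard deviations'' theorem, with the weight \<open>(N n)\<^bsup>1/4\<^esup>\<close> in place of
  the sharper \<open>\<surd>(n log (N / n))\<close>: it also decays geometrically along the recursion, and the
  two agree up to a constant factor when \<open>N\<close> is linear in \<open>n\<close>.\<close>

theorem exists_balanced_signing:
  fixes v :: "'i \<Rightarrow> 'a \<Rightarrow> real" and N :: real
  assumes "finite J" and I: "finite I" "card I \<le> N" and "card J \<le> N"
    and "\<And>i j. i \<in> I \<Longrightarrow> j \<in> J \<Longrightarrow> v i j \<in> {-1, 1}"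
  shows "\<exists>s. (\<forall>j\<in>J. s j \<in> {-1, 1}) \<and>
    (\<forall>i\<in>I. \<bar>\<Sum>j\<in>J. s j * v i j\<bar> \<le> 288 * sqrt (sqrt (N * card J)))"
  using assms(1,4,5)
proof (induction "card J" arbitrary: J rule: less_induct)
  case less
  show ?case
  proof (cases "J = {}")
    case False
    obtain P s where P: "P \<subseteq> J" "card J < 8 * card P" and s: "\<And>j. j \<in> P \<Longrightarrow> s j \<in> {-1, 1}"
      and disc: "\<And>i. i \<in> I \<Longrightarrow> \<bar>\<Sum>j\<in>P. s j * v i j\<bar> \<le> 9 * sqrt (sqrt (N * card J))"
      by (rule exists_balanced_partial_signing[OF less.prems(1) False I less.prems(2,3)]) auto
    have finP: "finite P" using P less.prems(1) finite_subset by blast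
    have card: "card (J - P) = card J - card P" "card P \<le> card J"
      using P less.prems(1) finP by (auto simp: card_Diff_subset card_mono)
    have rest: "8 * real (card (J - P)) \<le> 7 * real (card J)"
      using card P(2) by simp
    have N: "N \<ge> 0" using less.prems(2) by linarith
    have "\<exists>s. (\<forall>j\<in>J - P. s j \<in> {-1, 1}) \<and>
        (\<forall>i\<in>I. \<bar>\<Sum>j\<in>J - P. s j * v i j\<bar> \<le> 288 * sqrt (sqrt (N * card (J - P))))"
      using less.prems card P(2) by (intro less.hyps) auto
    then obtain s' where s': "\<And>j. j \<in> J - P \<Longrightarrow> s' j \<in> {-1, 1}"
      and disc': "\<And>i. i \<in> I \<Longrightarrow> \<bar>\<Sum>j\<in>J - P. s' j * v i j\<bar> \<le> 288 * sqrt (sqrt (N * card (J - P)))"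
      by blast
    \<comment> \<open>The remaining fraction 7/8 is at most \<open>(31/32) ^ 4\<close>, and the
      constant 288 closes the recursion because 9 + 288 * 31/32 = 288.\<close>
    have shrink: "sqrt (sqrt (N * card (J - P))) \<le> 31 / 32 * sqrt (sqrt (N * card J))"
    proof -
      have "N * card (J - P) \<le> N * ((31 / 32) ^ 4 * card J)"
        using rest N by (intro mult_left_mono) (auto simp: power4_eq_xxxx)
      then have "sqrt (sqrt (N * card (J - P))) \<le> sqrt (sqrt (((31 / 32)\<^sup>2)\<^sup>2 * (N * card J)))"
        by (simp add: mult_ac)
      also have "\<dots> = 31 / 32 * sqrt (sqrt (N * card J))"
        by (simp only: real_sqrt_mult real_sqrt_abs) simp
      finally show ?thesis .
    qed
    define t where "t j = (if j \<in> P then s j else s' j)" for j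
    show ?thesis
    proof (intro exI[of _ t] conjI ballI)
      show "t j \<in> {-1, 1}" if "j \<in> J" for j
        using s[of j] s'[of j] that by (auto simp: t_def)
      fix i assume i: "i \<in> I"
      have "(\<Sum>j\<in>J. t j * v i j) = (\<Sum>j\<in>J - P. t j * v i j) + (\<Sum>j\<in>P. t j * v i j)"
        using less.prems(1) P(1) by (rule sum.subset_diff[rotated])
      also have "\<dots> = (\<Sum>j\<in>J - P. s' j * v i j) + (\<Sum>j\<in>P. s j * v i j)"
        by (intro arg_cong2[where f = "(+)"] sum.cong) (auto simp: t_def)
      finally show "\<bar>\<Sum>j\<in>J. t j * v i j\<bar> \<le> 288 * sqrt (sqrt (N * card J))"
        using disc[OF i] disc'[OF i] shrink by linarith
    qed
  qed simp
qed

section \<open>Hyperplanes and spanning sets\<close>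

lemma finite_carrier_bit_vec: "finite (carrier_vec n :: bit vec set)"
proof -
  have "(UNIV :: bit set) = {0, 1}"
    by (auto intro: bit.exhaust)
  then have "finite (UNIV :: bit set)"
    by (metis finite.emptyI finite.insertI)
  then have "finite {xs :: bit list. set xs \<subseteq> UNIV \<and> length xs = n}"
    by (rule finite_lists_length_eq)
  moreover have "carrier_vec n \<subseteq> vec_of_list ` {xs :: bit list. set xs \<subseteq> UNIV \<and> length xs = n}"
    by (metis (mono_tags, lifting) carrier_vecD image_eqI length_list_of_vec mem_Collect_eq
        subsetI subset_UNIV vec_list)
  ultimately show ?thesis
    by (rule finite_surj)
qed

context vec_space
begin

text \<open>Take \<open>S\<close> maximal among the supersets of \<open>U\<close> with proper span.
  Adding any \<open>w\<close> outside \<open>span S\<close> generates everything, so a basis of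
  \<open>span S\<close> together with \<open>w\<close> is a basis of the whole space.\<close>

lemma proper_span_in_hyperplane:
  assumes fin: "finite (carrier_vec n :: 'a vec set)"
    and U: "U \<subseteq> carrier_vec n" and proper: "span U \<noteq> carrier_vec n"
  obtains H where "subspace class_ring H V" "vectorspace.dim class_ring (V\<lparr>carrier := H\<rparr>) + 1 = n"
    "U \<subseteq> H" "H \<noteq> carrier_vec n"
proof -
  define \<S> where "\<S> = {S. U \<subseteq> S \<and> S \<subseteq> carrier_vec n \<and> span S \<noteq> carrier_vec n}"
  have "\<S> \<subseteq> Pow (carrier_vec n)" by (auto simp: \<S>_def)
  then have "finite \<S>" by (rule finite_subset) (simp add: fin)
  moreover have "U \<in> \<S>" using U proper by (simp add: \<S>_def)
  ultimately obtain S where S: "S \<in> \<S>" and max: "\<And>S'. S' \<in> \<S> \<Longrightarrow> S \<subseteq> S' \<Longrightarrow> S' = S"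
    by (metis finite_has_maximal2)
  define H where "H = span S"
  have SC: "S \<subseteq> carrier_vec n" and US: "U \<subseteq> S" and Sp: "span S \<noteq> carrier_vec n"
    using S by (auto simp: \<S>_def)
  have HC: "H \<subseteq> carrier_vec n" unfolding H_def using SC by (rule span_is_subset2)
  have SH: "S \<subseteq> H" unfolding H_def using SC by (rule in_own_span)
  have sub: "subspace class_ring H V" unfolding H_def using SC by (intro span_is_subspace) simp
  then have subm: "submodule class_ring H V" by (simp add: subspace_def)
  \<comment> \<open>The dimension of \<open>H\<close> is taken in \<open>H\<close> as a space of its
    own; \<open>span_li_not_depend\<close> carries span and independence over to the ambient
    space.\<close>
  interpret H: vectorspace class_ring "V\<lparr>carrier := H\<rparr>"
    using sub by (rule subspace_is_vs)
  have finH: "finite H" using HC fin finite_subset by blast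
  have spanH: "span H = H" unfolding H_def using SC by (rule span_span)
  have "H.fin_dim"
    unfolding H.fin_dim_def using finH span_li_not_depend(1)[OF _ subm, of H] spanH by auto
  then obtain \<beta> where \<beta>: "finite \<beta>" "H.basis \<beta>" using H.finite_basis_exists by blast
  have \<beta>H: "\<beta> \<subseteq> H" using \<beta>(2) by (simp add: H.basis_def)
  have \<beta>C: "\<beta> \<subseteq> carrier_vec n" using \<beta>H HC by blast
  have sp\<beta>: "span \<beta> = H"
    using \<beta>(2) span_li_not_depend(1)[OF \<beta>H subm] by (simp add: H.basis_def)
  have li\<beta>: "lin_indpt \<beta>"
    using \<beta>(2) span_li_not_depend(2)[OF \<beta>H subm] by (simp add: H.basis_def)
  obtain w where w: "w \<in> carrier_vec n" "w \<notin> H"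
    using HC Sp by (auto simp: H_def)
  have w\<beta>: "w \<notin> \<beta>" using w \<beta>H by blast
  have li: "lin_indpt (\<beta> \<union> {w})"
    using lin_dep_iff_in_span[of \<beta> w] \<beta>C li\<beta> w w\<beta> sp\<beta> by auto
  have "insert w S \<notin> \<S>"
    using max[of "insert w S"] w SH by blast
  then have full: "span (insert w S) = carrier_vec n"
    using US SC w by (auto simp: \<S>_def)
  have C': "\<beta> \<union> {w} \<subseteq> carrier_vec n" using \<beta>C w by auto
  have "S \<subseteq> span (\<beta> \<union> {w})"
    using SH sp\<beta> span_is_monotone[of \<beta> "\<beta> \<union> {w}"] by blast
  moreover have "w \<in> span (\<beta> \<union> {w})" using in_own_span[of "\<beta> \<union> {w}"] C' by auto
  ultimately have "span (insert w S) \<subseteq> span (\<beta> \<union> {w})"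
    by (intro span_subsetI C') auto
  then have "span (\<beta> \<union> {w}) = carrier_vec n"
    using full span_is_subset2[of "\<beta> \<union> {w}"] C' by auto
  then have "basis (\<beta> \<union> {w})" using li C' by (simp add: basis_def)
  then have "card (\<beta> \<union> {w}) = n" using dim_basis[of "\<beta> \<union> {w}"] \<beta>(1) dim_is_n by simp
  then have "card \<beta> + 1 = n" using w\<beta> \<beta>(1) by simp
  moreover have "H.dim = card \<beta>" using \<beta> by (rule H.dim_basis)
  ultimately show thesis
    using that[OF sub] US SH HC w by auto
qed

text \<open>A minimal spanning subset is a basis. Its size \<open>n\<close> is what keeps the walks
  at length linear in \<open>n\<close>.\<close>

lemma spanning_set_contains_basis:
  assumes "finite U" "U \<subseteq> carrier_vec n" "span U = carrier_vec n"
  obtains Q where "Q \<subseteq> U" "finite Q" "card Q = n" "span Q = carrier_vec n"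
proof -
  obtain Q where Q: "Q \<subseteq> U" "minimal Q (\<lambda>S. S \<subseteq> carrier_vec n \<and> span S = carrier_vec n)"
    using minimal_exists[of U "\<lambda>S. S \<subseteq> carrier_vec n \<and> span S = carrier_vec n"] assms by auto
  have "basis Q" using min_gen_is_basis[of Q] Q(2) by simp
  moreover have "finite Q" using Q(1) assms(1) finite_subset by blast
  ultimately show thesis using that Q(1) dim_basis[of Q] dim_is_n by (auto simp: basis_def)
qed

end

section \<open>Alternating walks\<close>

lemma bit_vec_add_cancel:
  fixes x y :: "bit vec"
  assumes "x \<in> carrier_vec n" "y \<in> carrier_vec n"
  shows "x + (x + y) = y"
  using assms by (auto intro!: eq_vecI simp: add.assoc[symmetric])

text \<open>A hyperplane \<open>H\<close> containing \<open>X + Y\<close> forces \<open>X\<close>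
  into a single coset of \<open>H\<close>, since adding a fixed element of \<open>Y\<close> moves
  all of \<open>X\<close> into \<open>H\<close>. A different coset of \<open>H\<close> therefore
  misses \<open>X\<close>.\<close>

lemma exists_codim_1_coset_missing:
  fixes X Y :: "bit vec set"
  assumes X: "X \<subseteq> carrier_vec n" and Y: "Y \<subseteq> carrier_vec n" "Y \<noteq> {}"
    and U: "LinearCombinations.module.span class_ring (module_vec TYPE(bit) n) (X + Y) \<noteq> carrier_vec n"
  obtains S where "is_coset_codim_1 n S" "S \<subseteq> carrier_vec n" "S \<inter> X = {}"
proof -
  interpret vec_space "TYPE(bit)" n .
  have XY: "X + Y \<subseteq> carrier_vec n" using X Y by (auto simp: set_plus_def)
  obtain H where H: "subspace class_ring H V" "vectorspace.dim class_ring (V\<lparr>carrier := H\<rparr>) + 1 = n"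
    "X + Y \<subseteq> H" "H \<noteq> carrier_vec n"
    using proper_span_in_hyperplane[OF finite_carrier_bit_vec XY U] by blast
  then have subm: "submodule class_ring H V" by (simp add: subspace_def)
  have HC: "H \<subseteq> carrier_vec n" using submodule.subset[OF subm] by simp
  have Hadd: "g + h \<in> H" if "g \<in> H" "h \<in> H" for g h
    using submodule.m_closed[OF subm that] by simp
  have coset: "is_coset_codim_1 n (v +o H)" "v +o H \<subseteq> carrier_vec n" if "v \<in> carrier_vec n" for v
    using H(1,2) that HC by (auto simp: is_coset_codim_1_def elt_set_plus_def)
  obtain w where w: "w \<in> carrier_vec n" "w \<notin> H" using H(4) HC by blast
  show thesis
  proof (cases "X = {}")
    case True
    then show ?thesis using that[OF coset[OF w(1)]] by simp
  next
    case False
    then obtain x\<^sub>0 y\<^sub>0 where x\<^sub>0: "x\<^sub>0 \<in> X" and y\<^sub>0: "y\<^sub>0 \<in> Y" using Y by blast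
    have C: "x\<^sub>0 \<in> carrier_vec n" "y\<^sub>0 \<in> carrier_vec n" using x\<^sub>0 y\<^sub>0 X Y by auto
    have "(x\<^sub>0 + w) +o H \<inter> X = {}"
    proof (rule ccontr)
      assume "\<not> ?thesis"
      then obtain h where h: "h \<in> H" "x\<^sub>0 + w + h \<in> X" by (auto simp: elt_set_plus_def)
      have hC: "h \<in> carrier_vec n" using h HC by blast
      have "(x\<^sub>0 + w + h) + y\<^sub>0 \<in> H" "x\<^sub>0 + y\<^sub>0 \<in> H"
        using h(2) x\<^sub>0 y\<^sub>0 H(3) by (auto simp: set_plus_def)
      then have "((x\<^sub>0 + w + h) + y\<^sub>0) + (x\<^sub>0 + y\<^sub>0) + h \<in> H" using h Hadd by blast
      \<comment> \<open>All terms except \<open>w\<close> occur twice and cancel in characteristic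
        2.\<close>
      moreover have "((x\<^sub>0 + w + h) + y\<^sub>0) + (x\<^sub>0 + y\<^sub>0) + h = w"
        using C w hC
        by (intro eq_vecI) (auto simp: add_ac)
      ultimately show False using w by simp
    qed
    moreover have "x\<^sub>0 + w \<in> carrier_vec n" using C w by simp
    ultimately show ?thesis using that coset by blast
  qed
qed

lemma coset_codim_1_subset_carrier:
  assumes "is_coset_codim_1 n S"
  shows "S \<subseteq> carrier_vec n"
  using assms unfolding is_coset_codim_1_def
proof (elim bexE exE conjE)
  fix v H
  assume v: "v \<in> carrier_vec n" and H: "subspace class_ring H (module_vec TYPE(bit) n)"
    and S: "S = v +o H"
  have "H \<subseteq> carrier_vec n"
    using submodule.subset[OF subspace.submod[OF H]] by (simp add: module_vec_simps)
  then show ?thesis using v by (auto simp: S elt_set_plus_def)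
qed

text \<open>What has to be shown is that some coset of codimension 1 exists. The preceding
  construction supplies one for the empty set, whose span is proper once \<open>n\<close> is
  positive.\<close>

lemma meets_codim_1_cosets_nonempty:
  fixes X :: "bit vec set"
  assumes "0 < n" and "\<And>S. is_coset_codim_1 n S \<Longrightarrow> S \<inter> X \<noteq> {}"
  shows "X \<noteq> {}"
proof -
  interpret vec_space "TYPE(bit)" n .
  have "unit_vec n 0 \<noteq> (0\<^sub>v n :: bit vec)" using assms(1) by simp
  then have "span {} \<noteq> carrier_vec n" unfolding span_empty by (metis singletonD unit_vec_carrier)
  moreover have "{} + {0\<^sub>v n} = ({} :: bit vec set)" by (simp add: set_plus_def)
  ultimately obtain S :: "bit vec set" where "is_coset_codim_1 n S"
    using exists_codim_1_coset_missing[of "{}" n "{0\<^sub>v n}"] by auto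
  then show ?thesis using assms(2) by blast
qed

text \<open>Induction on \<open>Q\<close>, with two walk positions added for each
  \<open>u = x + y\<close> of coefficient 1. The set \<open>W\<close> of offsets is fixed before
  \<open>p\<close>, so that a single \<open>p\<close> can later be chosen to suit two walks at
  once.\<close>

lemma alternating_walk:
  fixes A B D X Y :: "bit vec set"
  assumes cover: "carrier_vec n = D \<union> A \<union> B"
    and X: "X \<subseteq> carrier_vec n" "X \<inter> (A + A) = {}" and Y: "Y \<subseteq> carrier_vec n" "Y \<inter> (B + B) = {}"
    and Q: "finite Q" "Q \<subseteq> X + Y"
  shows "\<exists>W. finite W \<and> W \<subseteq> carrier_vec n \<and> card W \<le> 2 * card Q \<and>
    (\<forall>p\<in>A. (\<forall>w\<in>W. p + w \<notin> D) \<longrightarrow>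
      p + module.lincomb (module_vec TYPE(bit) n) c Q \<in> A)"
  using Q
proof (induction Q rule: finite_induct)
  interpret vec_space "TYPE(bit)" n .
  case empty
  have "A \<subseteq> carrier_vec n" using cover by blast
  then show ?case by (intro exI[of _ "{}"]) (auto simp: lincomb_empty)
next
  interpret vec_space "TYPE(bit)" n .
  case (insert u Q)
  then obtain W where W: "finite W" "W \<subseteq> carrier_vec n" "card W \<le> 2 * card Q"
    and walk: "\<And>p. p \<in> A \<Longrightarrow> (\<And>w. w \<in> W \<Longrightarrow> p + w \<notin> D) \<Longrightarrow> p + lincomb c Q \<in> A"
    by auto
  obtain x y where xy: "x \<in> X" "y \<in> Y" "u = x + y" using insert.prems by (auto simp: set_plus_def)
  have C: "x \<in> carrier_vec n" "y \<in> carrier_vec n" "u \<in> carrier_vec n" using xy X Y by auto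
  have XY: "X + Y \<subseteq> carrier_vec n" using X Y by (auto simp: set_plus_def)
  then have QC: "Q \<subseteq> carrier_vec n" using insert.prems by blast
  define t where "t = lincomb c Q"
  have t: "t \<in> carrier_vec n" unfolding t_def using QC by (intro lincomb_closed) auto
  have step: "lincomb c (insert u Q) = c u \<cdot>\<^sub>v u + t"
    unfolding t_def using lincomb_insert2[of Q c u] insert.hyps QC C by simp
  show ?case
  proof (cases "c u = 0")
    case True
    then have "lincomb c (insert u Q) = t" using step t C by simp
    then show ?thesis using W walk insert.hyps by (intro exI[of _ W]) (auto simp: t_def)
  next
    case False
    then have "c u = 1" by (cases "c u") auto
    then have u: "lincomb c (insert u Q) = t + x + y"
      using step t C xy(3) by (auto simp: add.assoc comm_add_vec[of "x + y" n t])
    \<comment> \<open>The half step by \<open>x\<close> leads out of \<open>A\<close>, hence into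
      \<open>B\<close>, and the half step by \<open>y\<close> leads back from \<open>B\<close> to
      \<open>A\<close>.\<close>
    define W' where "W' = insert (t + x) (insert (t + x + y) W)"
    have "p + (t + x + y) \<in> A" if p: "p \<in> A" "\<And>w. w \<in> W' \<Longrightarrow> p + w \<notin> D" for p
    proof -
      have pC: "p \<in> carrier_vec n" using cover p by blast
      have A: "p + t \<in> A" unfolding t_def using p by (intro walk) (auto simp: W'_def)
      have "p + (t + x) \<notin> A"
      proof
        assume "p + (t + x) \<in> A"
        then have "(p + t) + (p + (t + x)) \<in> A + A" using A by (rule set_plus_intro[rotated])
        moreover have "(p + t) + (p + (t + x)) = x"
          using pC t C by (intro eq_vecI) (auto simp: add_ac)
        ultimately show False using xy X by auto
      qed
      moreover have "p + (t + x) \<in> D \<union> A \<union> B"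
        unfolding cover[symmetric] using pC t C by simp
      moreover have "p + (t + x) \<notin> D" using p(2) by (simp add: W'_def)
      ultimately have B: "p + (t + x) \<in> B" by blast
      have "p + (t + x + y) \<notin> B"
      proof
        assume "p + (t + x + y) \<in> B"
        then have "(p + (t + x)) + (p + (t + x + y)) \<in> B + B" using B by (rule set_plus_intro[rotated])
        moreover have "(p + (t + x)) + (p + (t + x + y)) = y"
          using pC t C by (intro eq_vecI) (auto simp: add_ac)
        ultimately show False using xy Y by auto
      qed
      moreover have "p + (t + x + y) \<in> D \<union> A \<union> B"
        unfolding cover[symmetric] using pC t C by simp
      moreover have "p + (t + x + y) \<notin> D" using p(2) by (simp add: W'_def)
      ultimately show ?thesis by blast
    qed
    moreover have "card W' \<le> 2 * card (insert u Q)"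
      unfolding W'_def using W insert.hyps by (auto simp: card_insert_if)
    ultimately show ?thesis
      using W t C unfolding u by (intro exI[of _ W']) (auto simp: W'_def)
  qed
qed

section \<open>Choice of the starting point\<close>

text \<open>Under \<open>sg\<close>, addition of bits becomes multiplication of signs, and the sum
  of the signs of a vector is \<open>n\<close> minus twice its weight. A signing balanced against
  all of \<open>W\<close> is thus a vector \<open>p\<close> whose translates all have weight near
  \<open>n / 2\<close>.\<close>

lemma exists_far_translation_point:
  fixes W :: "bit vec set"
  assumes W: "finite W" "W \<subseteq> carrier_vec n" "card W \<le> 5 * n"
  obtains p where "p \<in> carrier_vec n"
    "\<And>w. w \<in> W \<Longrightarrow> real n / 2 - 288 * sqrt n \<le> hamming_weight (p + w)"
proof -
  define sg :: "bit \<Rightarrow> real" where "sg b = (if b = 1 then -1 else 1)" for b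
  have sg_add: "sg (a + b) = sg a * sg b" for a b
    by (cases a; cases b) (simp_all add: sg_def)
  have weight: "(\<Sum>j<n. sg (x $ j)) = real n - 2 * hamming_weight x" if "x \<in> carrier_vec n" for x
  proof -
    have "(\<Sum>j<n. sg (x $ j)) = (\<Sum>j<n. 1 - 2 * (if x $ j = 1 then 1 else 0))"
      by (intro sum.cong) (auto simp: sg_def)
    also have "\<dots> = real n - 2 * (\<Sum>j<n. if x $ j = 1 then 1 else 0)"
      by (simp add: sum_subtractf sum_distrib_left)
    also have "(\<Sum>j<n. if x $ j = 1 then 1 else (0::real)) = card {j \<in> {..<n}. x $ j = 1}"
      by (subst sum.inter_filter[symmetric]) auto
    also have "{j \<in> {..<n}. x $ j = 1} = {i. i < dim_vec x \<and> x $ i = 1}"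
      using that by auto
    finally show ?thesis by (simp add: hamming_weight_def)
  qed
  have "\<exists>s. (\<forall>j\<in>{..<n}. s j \<in> {-1, 1}) \<and>
      (\<forall>w\<in>W. \<bar>\<Sum>j\<in>{..<n}. s j * sg (w $ j)\<bar> \<le> 288 * sqrt (sqrt (real (5 * n) * card {..<n})))"
    using W by (intro exists_balanced_signing) (auto simp: sg_def)
  then obtain s where s: "\<And>j. j < n \<Longrightarrow> s j \<in> {-1, 1}"
    and disc: "\<And>w. w \<in> W \<Longrightarrow> \<bar>\<Sum>j<n. s j * sg (w $ j)\<bar> \<le> 288 * sqrt (sqrt (real (5 * n) * card {..<n}))"
    by auto
  \<comment> \<open>The bound 5 * n on the number of vectors enters only through 5 \<le> 16, which
    yields the factor 2; halving later returns the constant 288.\<close>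
  have "sqrt (sqrt (real (5 * n) * card {..<n})) \<le> sqrt (sqrt ((4 * real n)\<^sup>2))"
    by (intro real_sqrt_le_mono) (simp add: power2_eq_square)
  also have "\<dots> = 2 * sqrt n" by (simp add: real_sqrt_mult)
  finally have bound: "sqrt (sqrt (real (5 * n) * card {..<n})) \<le> 2 * sqrt n" .
  define p where "p = vec n (\<lambda>j. if s j = 1 then 0 else 1 :: bit)"
  show thesis
  proof (rule that)
    show p: "p \<in> carrier_vec n" by (simp add: p_def)
    fix w assume w: "w \<in> W"
    then have wC: "w \<in> carrier_vec n" using W by blast
    have "(\<Sum>j<n. sg ((p + w) $ j)) = (\<Sum>j<n. s j * sg (w $ j))"
    proof (rule sum.cong)
      fix j assume j: "j \<in> {..<n}"
      have "sg (p $ j) = s j" using s[of j] j by (auto simp: p_def sg_def)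
      moreover have "(p + w) $ j = p $ j + w $ j" using j wC by (intro index_add_vec) auto
      ultimately show "sg ((p + w) $ j) = s j * sg (w $ j)" by (simp only: sg_add)
    qed simp
    then have "real n - 2 * hamming_weight (p + w) \<le> 288 * (2 * sqrt n)"
      using disc[OF w] bound weight[of "p + w"] p wC by auto
    then show "real n / 2 - 288 * sqrt n \<le> hamming_weight (p + w)" by simp
  qed
qed

section \<open>Conclusion\<close>

theorem theorem2:
  shows "\<exists>C > (0::real). \<exists>n\<^sub>0 :: nat. \<forall>n \<ge> n\<^sub>0. \<forall>r :: real. \<forall>A B :: bit vec set.
    r < real n / 2 - C * sqrt (real n) \<longrightarrow>
    A \<subseteq> carrier_vec n \<longrightarrow> B \<subseteq> carrier_vec n \<longrightarrow>
    carrier_vec n = hamming_ball n r \<union> A \<union> B \<longrightarrow>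
    (\<exists>S. is_coset_codim_1 n S \<and> (S \<subseteq> A + A \<or> S \<subseteq> B + B))"
proof -
  have "\<exists>S. is_coset_codim_1 n S \<and> (S \<subseteq> A + A \<or> S \<subseteq> B + B)"
    if n: "n \<ge> 1" and r: "r < real n / 2 - 288 * sqrt (real n)"
      and AC: "A \<subseteq> carrier_vec n" and BC: "B \<subseteq> carrier_vec n"
      and cover: "carrier_vec n = hamming_ball n r \<union> A \<union> B"
    for n :: nat and r :: real and A B :: "bit vec set"
  proof (rule ccontr)
    assume none: "\<not> ?thesis"
    interpret vec_space "TYPE(bit)" n .
    define X where "X = carrier_vec n - (A + A)"
    define Y where "Y = carrier_vec n - (B + B)"
    have XC: "X \<subseteq> carrier_vec n" "Y \<subseteq> carrier_vec n" by (auto simp: X_def Y_def)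
    have meets: "S \<inter> X \<noteq> {}" "S \<inter> Y \<noteq> {}" if "is_coset_codim_1 n S" for S
      using none that coset_codim_1_subset_carrier[OF that] by (auto simp: X_def Y_def)
    have n0: "0 < n" using n by simp
    have ne: "X \<noteq> {}" "Y \<noteq> {}"
      by (rule meets_codim_1_cosets_nonempty[OF n0], erule meets)+
    have "span (X + Y) = carrier_vec n"
      using exists_codim_1_coset_missing[OF XC ne(2)] meets(1) by metis
    moreover have XYC: "X + Y \<subseteq> carrier_vec n" using XC by (auto simp: set_plus_def)
    ultimately obtain Q where Q: "Q \<subseteq> X + Y" "finite Q" "card Q = n" "span Q = carrier_vec n"
      using spanning_set_contains_basis[OF finite_subset[OF _ finite_carrier_bit_vec]] by metis
    have QC: "Q \<subseteq> carrier_vec n" using Q XYC by blast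
    obtain x y where x: "x \<in> X" and y: "y \<in> Y" using ne by blast
    obtain c d where c: "x = lincomb c Q" and d: "y = lincomb d Q"
    proof -
      have "x \<in> span Q" "y \<in> span Q" using x y XC Q by auto
      then show thesis using that finite_span[OF Q(2)] QC by auto
    qed
    have disjoint: "X \<inter> (A + A) = {}" "Y \<inter> (B + B) = {}" by (auto simp: X_def Y_def)
    have cover': "carrier_vec n = hamming_ball n r \<union> B \<union> A" using cover by blast
    \<comment> \<open>The walk from \<open>B\<close> uses the same basis with its half steps in the
      opposite order; commuting them relies on both vectors having dimension
      \<open>n\<close>.\<close>
    have Q': "Q \<subseteq> Y + X"
    proof
      fix q assume "q \<in> Q"
      then obtain x y where "q = x + y" "x \<in> X" "y \<in> Y" using Q(1) by (auto simp: set_plus_def)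
      moreover from this have "q = y + x" using XC comm_add_vec[of x n y] by auto
      ultimately show "q \<in> Y + X" by (metis set_plus_intro)
    qed
    obtain W\<^sub>1 where W\<^sub>1: "finite W\<^sub>1" "W\<^sub>1 \<subseteq> carrier_vec n" "card W\<^sub>1 \<le> 2 * card Q"
      and walk\<^sub>1: "\<And>p. p \<in> A \<Longrightarrow> (\<And>w. w \<in> W\<^sub>1 \<Longrightarrow> p + w \<notin> hamming_ball n r) \<Longrightarrow> p + x \<in> A"
      using alternating_walk[OF cover XC(1) disjoint(1) XC(2) disjoint(2) Q(2,1), of c]
      unfolding c by auto
    obtain W\<^sub>2 where W\<^sub>2: "finite W\<^sub>2" "W\<^sub>2 \<subseteq> carrier_vec n" "card W\<^sub>2 \<le> 2 * card Q"
      and walk\<^sub>2: "\<And>p. p \<in> B \<Longrightarrow> (\<And>w. w \<in> W\<^sub>2 \<Longrightarrow> p + w \<notin> hamming_ball n r) \<Longrightarrow> p + y \<in> B"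
      using alternating_walk[OF cover' XC(2) disjoint(2) XC(1) disjoint(1) Q(2) Q', of d]
      unfolding d by auto
    \<comment> \<open>The zero vector is included so that \<open>p\<close> itself avoids the ball
      and hence lies in \<open>A\<close> or \<open>B\<close>. The count 4 * n + 1 is at most 5 * n
      because \<open>n \<ge> 1\<close>.\<close>
    define W where "W = insert (0\<^sub>v n) (W\<^sub>1 \<union> W\<^sub>2)"
    have "card W \<le> Suc (card (W\<^sub>1 \<union> W\<^sub>2))" using W\<^sub>1(1) W\<^sub>2(1) by (simp add: W_def card_insert_if)
    also have "\<dots> \<le> 5 * n" using card_Un_le[of W\<^sub>1 W\<^sub>2] W\<^sub>1(3) W\<^sub>2(3) Q(3) n by linarith
    finally have "card W \<le> 5 * n" .
    moreover have "finite W" "W \<subseteq> carrier_vec n" using W\<^sub>1 W\<^sub>2 by (auto simp: W_def)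
    ultimately obtain p where p: "p \<in> carrier_vec n"
      and far: "\<And>w. w \<in> W \<Longrightarrow> real n / 2 - 288 * sqrt n \<le> hamming_weight (p + w)"
      using exists_far_translation_point by metis
    have avoid: "p + w \<notin> hamming_ball n r" if "w \<in> W" for w
      using far[OF that] r by (auto simp: hamming_ball_def)
    have "p \<notin> hamming_ball n r" using avoid[of "0\<^sub>v n"] p by (simp add: W_def)
    then have "p \<in> A \<union> B" using p cover by blast
    then show False
    proof
      assume A: "p \<in> A"
      then have "p + x \<in> A" using avoid by (intro walk\<^sub>1) (auto simp: W_def)
      then have "p + (p + x) \<in> A + A" using A by (rule set_plus_intro[rotated])
      moreover have "p + (p + x) = x" using bit_vec_add_cancel[OF p] x XC by blast
      ultimately show False using x disjoint by auto
    next
      assume B: "p \<in> B"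
      then have "p + y \<in> B" using avoid by (intro walk\<^sub>2) (auto simp: W_def)
      then have "p + (p + y) \<in> B + B" using B by (rule set_plus_intro[rotated])
      moreover have "p + (p + y) = y" using bit_vec_add_cancel[OF p] y XC by blast
      ultimately show False using y disjoint by auto
    qed
  qed
  then show ?thesis by (intro exI[of _ 288] conjI exI[of _ 1]) auto
qed

end
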